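(* Let $q$ be a power of $2$, $\mathcal{O}=\mathbb{F}_q[[t]]$, and $\mathcal{O}_i=\mathbb{F}_q[[t]]/(t^i)$. Let $r\ge2$, $l'=\lfloor r/2\rfloor$, let $\beta\in\mathrm{M}_2(\mathcal{O}_{l'})$ be of type 3, let $\hat\beta\in\mathrm{M}_2(\mathcal{O}_r)$ be a lift of $\beta$, and for $1\le i\le r$ let $\beta_i$ be the image of $\hat\beta$ in $\mathrm{M}_2(\mathcal{O}_i)$. Let $SC_i=C_{\mathrm{GL}_2(\mathcal{O}_i)}(\beta_i)\cap\mathrm{SL}_2(\mathcal{O}_i)$. Then, for every $1\le i\le r$, $$|SC_i|=c\,q^{\,i+\delta(\beta_i)}\quad\text{for some } c\in\{1,2,3\}.$$
   Context: $C_{\mathrm{GL}_2(\mathcal{O}_i)}(\beta_i)$ denotes the centraliser of $\beta_i$ in $\mathrm{GL}_2(\mathcal{O}_i)$ (acting by conjugation). A matrix $\alpha\in\mathrm{M}_2(\mathcal{O}_i)$ is of type 3 if it is $\mathrm{GL}_2(\mathcal{O}_i)$-conjugate to a matrix $\begin{bmatrix}0&1\\-\Delta&\tau\end{bmatrix}$ with $x^2+\tau x+\Delta\equiv(x-a)^2 \bmod (t)$ for some $a\in\mathcal{O}_i$; equivalently, its reduction mod $(t)$ is a scalar plus a non-zero nilpotent matrix. If $\beta$ is of type 3, so is each $\beta_i$. For $\alpha\in\mathrm{M}_2(\mathcal{O}_i)$ of type 3, write $\tau=\mathrm{tr}(\alpha)$ and $\det(\alpha)=\Delta_0+\Delta_1t+\dots+\Delta_{i-1}t^{i-1}$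 with $\Delta_k\in\mathbb{F}_q$. Let $w(\alpha)$ be the $t$-valuation of $\tau$ if $\tau\ne0$, and $w(\alpha)=i$ if $\tau=0$. Put $M=\lfloor w(\alpha)/2\rfloor$. The odd depth $\delta(\alpha)$ is the smallest integer $k$ with $0\le k<M$ and $\Delta_{2k+1}\ne0$, if such $k$ exists; otherwise $\delta(\alpha)=M$. *)

theory Defs
  imports
    "HOL-Analysis.Determinants"
    "HOL-Computational_Algebra.Formal_Power_Series"
    "HOL-Computational_Algebra.Polynomial"
    "HOL-Algebra.QuotRing"
begin

text \<open>
  The finite field \<open>\<F>\<^sub>q\<close> is a type \<open>'a\<close> of class \<open>field\<close>, and \<open>\<O> = \<F>\<^sub>q[[t]]\<close> is \<open>'a fps\<close> with \<open>t\<close>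
  written \<open>fps_X\<close>. Since the exponent \<open>i\<close> varies inside a single statement, \<open>\<O>\<^sub>i = \<O>/(t\<^sup>i)\<close> is a
  ring on a carrier set: each residue class is represented by its unique member
  \<open>c\<^sub>0 + \<dots> + c\<^bsub>i-1\<^esub>t\<^bsup>i-1\<^esup>\<close>, and \<open>fps_cutoff i\<close> is the reduction map from \<open>\<O>\<close>, or from \<open>\<O>\<^sub>j\<close> with
  \<open>j \<ge> i\<close>. That this is the quotient ring is the lemma \<open>quotient_iso_Oi\<close> below.
\<close>

definition Oi :: "nat \<Rightarrow> 'a::field fps ring" where
  "Oi i = \<lparr>carrier = range (fps_cutoff i),
           mult = (\<lambda>f g. fps_cutoff i (f * g)), one = fps_cutoff i 1,
           zero = 0, add = (+)\<rparr>"

definition fps_ring :: "'a::field fps ring" where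
  "fps_ring = \<lparr>carrier = UNIV, mult = (*), one = 1, zero = 0, add = (+)\<rparr>"

definition red :: "nat \<Rightarrow> 'a::field fps ^ 2 ^ 2 \<Rightarrow> 'a fps ^ 2 ^ 2" where
  "red i = map_matrix (fps_cutoff i)"

definition M2 :: "nat \<Rightarrow> ('a::field fps ^ 2 ^ 2) ring" where
  "M2 i = \<lparr>carrier = {A. \<forall>j k. A $ j $ k \<in> carrier (Oi i)},
           mult = (\<lambda>A B. red i (A ** B)), one = red i (mat 1),
           zero = 0, add = (+)\<rparr>"

definition tr_Oi :: "nat \<Rightarrow> 'a::field fps ^ 2 ^ 2 \<Rightarrow> 'a fps" where
  "tr_Oi i A = fps_cutoff i (trace A)"

definition det_Oi :: "nat \<Rightarrow> 'a::field fps ^ 2 ^ 2 \<Rightarrow> 'a fps" where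
  "det_Oi i A = fps_cutoff i (det A)"

definition GL2 :: "nat \<Rightarrow> ('a::field fps ^ 2 ^ 2) set" where
  "GL2 i = Units (M2 i)"

definition SL2 :: "nat \<Rightarrow> ('a::field fps ^ 2 ^ 2) set" where
  "SL2 i = {A \<in> carrier (M2 i). det_Oi i A = \<one>\<^bsub>Oi i\<^esub>}"

definition conj_M2 :: "nat \<Rightarrow> 'a::field fps ^ 2 ^ 2 \<Rightarrow> 'a fps ^ 2 ^ 2 \<Rightarrow> 'a fps ^ 2 ^ 2" where
  "conj_M2 i g A = g \<otimes>\<^bsub>M2 i\<^esub> A \<otimes>\<^bsub>M2 i\<^esub> inv\<^bsub>M2 i\<^esub> g"

definition centraliser_GL2 :: "nat \<Rightarrow> 'a::field fps ^ 2 ^ 2 \<Rightarrow> ('a fps ^ 2 ^ 2) set" where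
  "centraliser_GL2 i A = {g \<in> GL2 i. conj_M2 i g A = A}"

definition companion2 :: "'a::field fps \<Rightarrow> 'a fps \<Rightarrow> 'a fps ^ 2 ^ 2" where
  "companion2 \<Delta> \<tau> = vector [vector [0, 1], vector [- \<Delta>, \<tau>]]"

text \<open>
  The congruence \<open>x\<^sup>2 + \<tau>x + \<Delta> \<equiv> (x - a)\<^sup>2 mod (t)\<close> is one of polynomials in \<open>x\<close>, that is,
  coefficientwise; it involves only constant terms, so for \<open>i \<ge> 1\<close> it may be tested on the
  representatives in \<open>\<O>\<close>.
\<close>

definition type3 :: "nat \<Rightarrow> 'a::field fps ^ 2 ^ 2 \<Rightarrow> bool" where
  "type3 i A \<longleftrightarrow> A \<in> carrier (M2 i) \<and>
     (\<exists>g \<in> GL2 i. \<exists>\<Delta> \<in> carrier (Oi i). \<exists>\<tau> \<in> carrier (Oi i).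
        conj_M2 i g A = companion2 \<Delta> \<tau> \<and>
        (\<exists>a \<in> carrier (Oi i). [:fps_X:] dvd [:\<Delta>, \<tau>, 1:] - [:- a, 1:] ^ 2))"

definition tr_val :: "nat \<Rightarrow> 'a::field fps ^ 2 ^ 2 \<Rightarrow> nat" where
  "tr_val i A = (if tr_Oi i A = 0 then i else subdegree (tr_Oi i A))"

definition odd_depth :: "nat \<Rightarrow> 'a::field fps ^ 2 ^ 2 \<Rightarrow> nat" where
  "odd_depth i A =
     (let M = tr_val i A div 2;
          P = (\<lambda>k. k < M \<and> fps_nth (det_Oi i A) (2 * k + 1) \<noteq> 0)
      in if \<exists>k. P k then LEAST k. P k else M)"

lemma fps_cutoff_idem: "fps_cutoff i (fps_cutoff i f) = fps_cutoff i (f :: 'a::field fps)"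
  by (simp add: fps_eq_iff)

lemma fps_cutoff_mult:
  "fps_cutoff i (fps_cutoff i f * fps_cutoff i g) = fps_cutoff i (f * g :: 'a::field fps)"
  by (simp add: fps_cutoff_eq_fps_cutoff_iff fps_cutoff_left_mult_nth fps_cutoff_right_mult_nth)

lemma in_Oi_iff: "f \<in> carrier (Oi i) \<longleftrightarrow> fps_cutoff i f = f"
  unfolding Oi_def by (auto simp: fps_cutoff_idem intro: range_eqI[OF sym])

lemma cring_fps_ring: "cring (fps_ring :: 'a::field fps ring)"
proof (rule cringI)
  show "abelian_group (fps_ring :: 'a fps ring)"
  proof (rule abelian_groupI)
    show "\<exists>y\<in>carrier fps_ring. y \<oplus>\<^bsub>fps_ring\<^esub> x = \<zero>\<^bsub>fps_ring\<^esub>" for x :: "'a fps"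
      by (rule bexI[of _ "- x"]) (simp_all add: fps_ring_def)
  qed (simp_all add: fps_ring_def algebra_simps)
  show "comm_monoid (fps_ring :: 'a fps ring)"
    by (rule comm_monoidI) (simp_all add: fps_ring_def algebra_simps)
qed (simp_all add: fps_ring_def algebra_simps)

lemma fps_cutoff_hom: "fps_cutoff i \<in> ring_hom fps_ring (Oi i)"
  by (rule ring_hom_memI) (simp_all add: Oi_def fps_ring_def fps_cutoff_mult fps_cutoff_add)

lemma cring_Oi: "cring (Oi i :: 'a::field fps ring)"
proof (rule cringI)
  have cl: "fps_cutoff i (f * g) \<in> carrier (Oi i)" for f g :: "'a fps"
    by (simp add: in_Oi_iff fps_cutoff_idem)
  show "abelian_group (Oi i :: 'a fps ring)"
  proof (rule abelian_groupI)
    show "\<exists>y\<in>carrier (Oi i). y \<oplus>\<^bsub>Oi i\<^esub> x = \<zero>\<^bsub>Oi i\<^esub>"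
      if "x \<in> carrier (Oi i)" for x :: "'a fps"
      using that by (intro bexI[of _ "- x"]) (simp add: Oi_def, simp add: in_Oi_iff fps_cutoff_uminus)
    show "x \<oplus>\<^bsub>Oi i\<^esub> y \<in> carrier (Oi i)"
      if "x \<in> carrier (Oi i)" "y \<in> carrier (Oi i)" for x y :: "'a fps"
      using that by (simp only: in_Oi_iff) (simp add: Oi_def fps_cutoff_add)
    show "\<zero>\<^bsub>Oi i\<^esub> \<in> carrier (Oi i :: 'a fps ring)"
      by (simp only: in_Oi_iff) (simp add: Oi_def)
  qed (simp_all add: Oi_def algebra_simps)
  show "comm_monoid (Oi i :: 'a fps ring)"
  proof (rule comm_monoidI)
    fix x y z :: "'a fps"
    assume *: "x \<in> carrier (Oi i)" "y \<in> carrier (Oi i)" "z \<in> carrier (Oi i)"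
    note c = *[unfolded in_Oi_iff]
    have "fps_cutoff i (fps_cutoff i (x * y) * z) = fps_cutoff i (x * y * z)"
      using fps_cutoff_mult[of i "x * y" z] c by simp
    moreover have "fps_cutoff i (x * fps_cutoff i (y * z)) = fps_cutoff i (x * (y * z))"
      using fps_cutoff_mult[of i x "y * z"] c by simp
    ultimately show "x \<otimes>\<^bsub>Oi i\<^esub> y \<otimes>\<^bsub>Oi i\<^esub> z = x \<otimes>\<^bsub>Oi i\<^esub> (y \<otimes>\<^bsub>Oi i\<^esub> z)"
      by (simp add: Oi_def mult.assoc)
  next
    fix x :: "'a fps"
    assume "x \<in> carrier (Oi i)"
    then show "\<one>\<^bsub>Oi i\<^esub> \<otimes>\<^bsub>Oi i\<^esub> x = x"
      using fps_cutoff_mult[of i 1 x] by (simp only: in_Oi_iff) (simp add: Oi_def)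
  qed (simp_all add: Oi_def mult.commute)
  show "(x \<oplus>\<^bsub>Oi i\<^esub> y) \<otimes>\<^bsub>Oi i\<^esub> z = x \<otimes>\<^bsub>Oi i\<^esub> z \<oplus>\<^bsub>Oi i\<^esub> y \<otimes>\<^bsub>Oi i\<^esub> z" for x y z :: "'a fps"
    by (simp add: Oi_def distrib_right fps_cutoff_add)
qed

lemma kernel_fps_cutoff:
  "a_kernel fps_ring (Oi i) (fps_cutoff i) = PIdl\<^bsub>fps_ring\<^esub> (fps_X ^ i :: 'a::field fps)"
proof -
  have "fps_cutoff i f = 0 \<longleftrightarrow> (\<exists>g. f = g * fps_X ^ i)" for f :: "'a fps"
  proof
    assume "fps_cutoff i f = 0"
    then show "\<exists>g. f = g * fps_X ^ i"
      using fps_shift_cutoff[of i f] by (metis add.right_neutral)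
  next
    assume "\<exists>g. f = g * fps_X ^ i"
    then show "fps_cutoff i f = 0"
      by (auto simp: fps_eq_iff fps_X_power_mult_right_nth)
  qed
  then show ?thesis
    by (auto simp: a_kernel_def kernel_def cgenideal_def fps_ring_def Oi_def)
qed

lemma quotient_iso_Oi:
  "fps_ring Quot (PIdl\<^bsub>fps_ring\<^esub> (fps_X ^ i :: 'a fps)) \<simeq> (Oi i :: 'a::field fps ring)"
proof -
  interpret ring_hom_ring fps_ring "Oi i :: 'a fps ring" "fps_cutoff i"
    by (intro ring_hom_ringI2 cring.axioms(1) cring_fps_ring cring_Oi fps_cutoff_hom)
  have "fps_cutoff i ` carrier fps_ring = carrier (Oi i :: 'a fps ring)"
    by (simp add: fps_ring_def Oi_def)
  from FactRing_iso[OF this] show ?thesis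
    by (simp only: kernel_fps_cutoff)
qed

lemma red_mult: "red i (red i A ** red i B) = red i (A ** B)"
  by (simp add: red_def vec_eq_iff matrix_matrix_mult_def fps_cutoff_add fps_cutoff_mult sum_2)

lemma red_idem: "red i (red i A) = red i A"
  by (simp add: red_def vec_eq_iff fps_cutoff_idem)

lemma red_add: "red i (A + B) = red i A + red i B"
  by (simp add: red_def vec_eq_iff fps_cutoff_add)

lemma in_M2_iff: "A \<in> carrier (M2 i) \<longleftrightarrow> red i A = A"
  by (simp add: M2_def in_Oi_iff red_def vec_eq_iff)

lemma ring_M2: "ring (M2 i :: ('a::field fps ^ 2 ^ 2) ring)"
proof (rule ringI)
  show "abelian_group (M2 i :: ('a fps ^ 2 ^ 2) ring)"
  proof (rule abelian_groupI)
    show "\<exists>y\<in>carrier (M2 i). y \<oplus>\<^bsub>M2 i\<^esub> x = \<zero>\<^bsub>M2 i\<^esub>"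
      if "x \<in> carrier (M2 i)" for x :: "'a fps ^ 2 ^ 2"
      using that
      by (intro bexI[of _ "- x"])
         (simp add: M2_def, simp add: in_M2_iff red_def vec_eq_iff fps_cutoff_uminus)
    show "x \<oplus>\<^bsub>M2 i\<^esub> y \<in> carrier (M2 i)"
      if "x \<in> carrier (M2 i)" "y \<in> carrier (M2 i)" for x y :: "'a fps ^ 2 ^ 2"
      using that by (simp only: in_M2_iff) (simp add: M2_def red_add)
    show "\<zero>\<^bsub>M2 i\<^esub> \<in> carrier (M2 i :: ('a fps ^ 2 ^ 2) ring)"
      by (simp only: in_M2_iff) (simp add: M2_def red_def vec_eq_iff)
  qed (simp_all add: M2_def algebra_simps)
  show "monoid (M2 i :: ('a fps ^ 2 ^ 2) ring)"
  proof (rule monoidI)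
    fix x y z :: "'a fps ^ 2 ^ 2"
    assume *: "x \<in> carrier (M2 i)" "y \<in> carrier (M2 i)" "z \<in> carrier (M2 i)"
    note c = *[unfolded in_M2_iff]
    have "red i (red i (x ** y) ** z) = red i (x ** y ** z)"
      using red_mult[of i "x ** y" z] c by (simp add: red_idem)
    moreover have "red i (x ** red i (y ** z)) = red i (x ** (y ** z))"
      using red_mult[of i x "y ** z"] c by (simp add: red_idem)
    ultimately show "x \<otimes>\<^bsub>M2 i\<^esub> y \<otimes>\<^bsub>M2 i\<^esub> z = x \<otimes>\<^bsub>M2 i\<^esub> (y \<otimes>\<^bsub>M2 i\<^esub> z)"
      by (simp add: M2_def matrix_mul_assoc)
  next
    fix x :: "'a fps ^ 2 ^ 2"
    assume "x \<in> carrier (M2 i)"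
    then have c: "red i x = x" by (simp only: in_M2_iff)
    show "\<one>\<^bsub>M2 i\<^esub> \<otimes>\<^bsub>M2 i\<^esub> x = x"
      using red_mult[of i "mat 1" x] c by (simp add: M2_def)
    show "x \<otimes>\<^bsub>M2 i\<^esub> \<one>\<^bsub>M2 i\<^esub> = x"
      using red_mult[of i x "mat 1"] c by (simp add: M2_def)
  next
    show "\<one>\<^bsub>M2 i\<^esub> \<in> carrier (M2 i :: ('a fps ^ 2 ^ 2) ring)"
      by (simp only: in_M2_iff) (simp add: M2_def red_idem)
    show "x \<otimes>\<^bsub>M2 i\<^esub> y \<in> carrier (M2 i)" for x y :: "'a fps ^ 2 ^ 2"
      by (simp only: in_M2_iff) (simp add: M2_def red_idem)
  qed
qed (simp_all add: M2_def red_def vec_eq_iff matrix_matrix_mult_def fps_cutoff_add sum_2 algebra_simps)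

end

theory Submission
  imports Defs "HOL-Number_Theory.Residues"
begin

text \<open>
  Write \<open>A\<close> for the given matrix over \<open>\<O>\<^sub>i\<close>, \<open>T\<close> for its trace, \<open>w\<close> for the valuation of \<open>T\<close> and
  \<open>\<delta>\<close> for the odd depth. Type 3 says that \<open>T\<close> vanishes mod \<open>t\<close> and, the characteristic being 2,
  that some off-diagonal entry of \<open>A\<close> is a unit (lemma \<open>type3_residue\<close>). Hence the commutant of \<open>A\<close>
  consists of the linear polynomials in \<open>A\<close>, and of its elements those of determinant 1 form the
  group to be counted.

  Since \<open>\<F>\<^sub>q\<close> is perfect, there is a series \<open>d\<close> whose square has the same even coefficients as
  \<open>det A\<close>. In the basis \<open>1, A + d\<close> of the commutant the determinant becomes the norm form
  \<open>N(x, y) = x\<^sup>2 + T x y + D y\<^sup>2\<close> with \<open>D = det A + d T + d\<^sup>2\<close>. Below \<open>t\<^sup>w\<close> only the odd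
  coefficients of \<open>det A\<close> survive in \<open>D\<close>, so either \<open>D\<close> has valuation \<open>2\<delta> + 1 < w\<close>, or \<open>D\<close>
  vanishes mod \<open>t\<^sup>w\<close> and \<open>w \<in> {2\<delta>, 2\<delta> + 1}\<close> (lemma \<open>depth_form_tr_val_odd_depth\<close>).

  Let \<open>S\<^sub>n\<close> be the group of pairs mod \<open>t\<^sup>i\<close> with \<open>N \<equiv> 1\<close> mod \<open>t\<^sup>n\<close>. Then
  \<open>|S\<^sub>1| = q\<^bsup>2i-1\<^esup>\<close>, and for \<open>1 \<le> n < i\<close> the coefficient of \<open>t\<^sup>n\<close> in \<open>N\<close> is a homomorphism from
  \<open>S\<^sub>n\<close> to the additive group of \<open>\<F>\<^sub>q\<close> with kernel \<open>S\<^bsub>n+1\<^esub>\<close>. Its image is as follows.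

    \<^item> For even \<open>n\<close> it is \<open>\<F>\<^sub>q\<close>, by squares of \<open>1 + s t\<^bsup>n/2\<^esup>\<close>.
    \<^item> For odd \<open>n < 2\<delta>\<close> it is 0, because \<open>N \<equiv> x\<^sup>2\<close> mod \<open>t\<^bsup>2\<delta>\<^esup>\<close> and squares have no odd coefficients.
    \<^item> For odd \<open>n > 2\<delta>\<close> it is \<open>\<F>\<^sub>q\<close>, by the norms of \<open>(1, c t\<^sup>k)\<close> for a suitable \<open>k\<close>, except that for
      the one index at which the terms \<open>T x y\<close> and \<open>D y\<^sup>2\<close> meet, \<open>n = 2w - v\<close> with \<open>v\<close> the valuation
      of \<open>D\<close>, these norms yield only the range of an Artin-Schreier map \<open>c \<mapsto> a c + b c\<^sup>2\<close>, which has
      index 2.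

  So \<open>|S\<^sub>i| = q\<^bsup>2i-1-(i-1-\<delta>)\<^esup>\<close> in general, and twice that if the exceptional index occurs below
  \<open>i\<close> and its image has index 2. In particular the value \<open>c = 3\<close> never occurs.
\<close>

section \<open>Characteristic 2\<close>

lemma CHAR_eq_2I:
  assumes "CARD('a::{field,finite}) = 2 ^ e"
  shows "CHAR('a) = 2"
proof -
  have "CHAR('a) dvd 2 ^ e"
    using CHAR_dvd_CARD[where 'a = 'a] assms by simp
  moreover have "prime CHAR('a)"
    by (intro prime_CHAR_semidom finite_imp_CHAR_pos) simp
  ultimately show ?thesis
    using prime_dvd_power primes_dvd_imp_eq two_is_prime_nat by blast
qed

lemma add_self_CHAR_2:
  fixes x :: "'a::ring_1"
  assumes "CHAR('a) = 2"
  shows "x + x = 0"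
  by (metis assms diff_self minus_CHAR_2)

lemma square_add_CHAR_2:
  fixes x y :: "'a::comm_ring_1"
  assumes "CHAR('a) = 2"
  shows "(x + y)\<^sup>2 = x\<^sup>2 + y\<^sup>2"
  by (rule freshmans_dream) (simp_all add: assms)

lemma ex_sqrt_CHAR_2:
  assumes "CHAR('a::{field,finite}) = 2"
  shows "\<exists>s. s\<^sup>2 = (a :: 'a)"
proof -
  have "inj (\<lambda>x::'a. x\<^sup>2)"
  proof (rule injI)
    fix x y :: 'a
    assume "x\<^sup>2 = y\<^sup>2"
    then have "(x + y)\<^sup>2 = 0"
      using square_add_CHAR_2[OF assms, of x y] add_self_CHAR_2[OF assms] by metis
    then show "x = y"
      using minus_CHAR_2[OF assms, of x y] by simp
  qed
  then have "surj (\<lambda>x::'a. x\<^sup>2)"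
    by (simp add: finite_UNIV_inj_surj)
  then show ?thesis
    by (metis surjE)
qed

lemma fps_square_nth_CHAR_2:
  fixes f :: "'a::comm_ring_1 fps"
  assumes "CHAR('a) = 2"
  shows "fps_nth (f\<^sup>2) n = (if even n then (fps_nth f (n div 2))\<^sup>2 else 0)"
proof (induction n arbitrary: f rule: less_induct)
  case (less n)
  \<comment> \<open>Squaring \<open>f = f\<^sub>0 + t f'\<close> reduces the coefficient at \<open>n\<close> to the one of \<open>f'\<^sup>2\<close> at \<open>n - 2\<close>.\<close>
  have dec: "f\<^sup>2 = fps_const ((fps_nth f 0)\<^sup>2) + fps_X ^ 2 * (fps_shift 1 f)\<^sup>2"
  proof -
    have "f = fps_const (fps_nth f 0) + fps_X * fps_shift 1 f"
      by (intro fps_ext) (simp add: fps_X_mult_nth)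
    then have "f\<^sup>2 = (fps_const (fps_nth f 0) + fps_X * fps_shift 1 f)\<^sup>2"
      by simp
    also have "\<dots> = fps_const ((fps_nth f 0)\<^sup>2) + fps_X ^ 2 * (fps_shift 1 f)\<^sup>2"
      using assms by (subst square_add_CHAR_2) (simp_all add: power_mult_distrib flip: fps_const_power)
    finally show ?thesis .
  qed
  consider "n = 0" | "n = 1" | m where "n = m + 2"
    by (metis One_nat_def add_2_eq_Suc' not0_implies_Suc)
  then show ?case
  proof cases
    case 1
    have "fps_nth (f\<^sup>2) 0 = (fps_nth f 0)\<^sup>2"
      by (subst dec) (simp add: fps_X_power_mult_nth)
    with 1 show ?thesis by simp
  next
    case 2
    have "fps_nth (f\<^sup>2) 1 = 0"
      by (subst dec) (simp add: fps_X_power_mult_nth)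
    with 2 show ?thesis by simp
  next
    case 3
    have "fps_nth (f\<^sup>2) (m + 2) = fps_nth ((fps_shift 1 f)\<^sup>2) m"
      by (subst dec) (simp add: fps_X_power_mult_nth)
    with 3 show ?thesis
      using less.IH[of m "fps_shift 1 f"] by simp
  qed
qed

section \<open>Counting along homomorphisms into additive groups of characteristic 2\<close>

text \<open>
  The order formula for the kernel and the image of a homomorphism. The operation \<open>m\<close> is only asked
  to be closed and left cancellative on a finite set.
\<close>
lemma card_eq_kernel_times_image_CHAR_2:
  fixes f :: "'s \<Rightarrow> 'b::ring_1" and m :: "'s \<Rightarrow> 's \<Rightarrow> 's"
  assumes "CHAR('b) = 2" and fin: "finite S"
    and cl: "\<And>a b. a \<in> S \<Longrightarrow> b \<in> S \<Longrightarrow> m a b \<in> S"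
    and hom: "\<And>a b. a \<in> S \<Longrightarrow> b \<in> S \<Longrightarrow> f (m a b) = f a + f b"
    and inj: "\<And>a. a \<in> S \<Longrightarrow> inj_on (m a) S"
  shows "card S = card {s \<in> S. f s = 0} * card (f ` S)"
proof -
  have fibre: "card {s \<in> S. f s = v} = card {s \<in> S. f s = 0}" if v: "v \<in> f ` S" for v
  proof -
    from v obtain a where a: "a \<in> S" "f a = v" by blast
    have vv: "v + v = 0"
      using assms(1) by (rule add_self_CHAR_2)
    \<comment> \<open>As \<open>v + v = 0\<close>, multiplication by \<open>a\<close> exchanges the kernel and the fibre of \<open>a\<close>, so that no
      inverse of \<open>a\<close> is needed.\<close>
    have "m a ` {s \<in> S. f s = v} \<subseteq> {s \<in> S. f s = 0}" "m a ` {s \<in> S. f s = 0} \<subseteq> {s \<in> S. f s = v}"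
      using a cl hom vv by auto
    moreover have "inj_on (m a) {s \<in> S. f s = v}" "inj_on (m a) {s \<in> S. f s = 0}"
      using inj[OF a(1)] by (auto intro: inj_on_subset)
    ultimately show ?thesis
      using fin by (intro antisym card_inj_on_le[of "m a"]) auto
  qed
  have "card S = (\<Sum>v\<in>f ` S. card {s \<in> S. f s = v})"
    using sum.image_gen[OF fin, of "\<lambda>_. 1::nat" f] by simp
  also have "\<dots> = (\<Sum>v\<in>f ` S. card {s \<in> S. f s = 0})"
    using fibre by simp
  finally show ?thesis
    by simp
qed

lemma card_artin_schreier_image:
  fixes a b :: "'a::{field,finite}"
  assumes "CHAR('a) = 2" "a \<noteq> 0" "b \<noteq> 0"
  shows "2 * card (range (\<lambda>c. a * c + b * c\<^sup>2)) = CARD('a)"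
proof -
  let ?f = "\<lambda>c. a * c + b * c\<^sup>2"
  have "card (UNIV :: 'a set) = card {c \<in> UNIV. ?f c = 0} * card (range ?f)"
    using assms(1)
    by (intro card_eq_kernel_times_image_CHAR_2[where m = "(+)"])
      (simp_all add: square_add_CHAR_2 algebra_simps)
  moreover have "?f c = 0 \<longleftrightarrow> c = 0 \<or> c = a / b" for c
  proof -
    have "?f c = b * c * (c - a / b)"
      using assms by (simp add: field_simps minus_CHAR_2 power2_eq_square)
    then show ?thesis
      using assms by auto
  qed
  then have "{c \<in> UNIV. ?f c = 0} = {0, a / b}"
    by auto
  ultimately show ?thesis
    using assms by simp
qed

text \<open>
  An additive subgroup containing a subset of half the size of the field is the whole field or has
  index 2.
\<close>
lemma card_add_closed_CHAR_2:
  fixes V W :: "'a::{field,finite} set"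
  assumes "CHAR('a) = 2" and cl: "\<And>u v. u \<in> V \<Longrightarrow> v \<in> V \<Longrightarrow> u + v \<in> V"
    and "W \<subseteq> V" and W: "2 * card W = CARD('a)"
  shows "card V = CARD('a) \<or> 2 * card V = CARD('a)"
proof (cases "V = UNIV")
  case False
  then obtain v where v: "v \<notin> V" by blast
  have "V \<inter> (+) v ` V = {}"
  proof (rule ccontr)
    assume "V \<inter> (+) v ` V \<noteq> {}"
    then obtain a where a: "a \<in> V" "v + a \<in> V" by blast
    then have "v + a + a \<in> V" using cl by blast
    then show False
      using v add_self_CHAR_2[OF assms(1), of a] by (simp add: add.assoc)
  qed
  then have "card (V \<union> (+) v ` V) = card V + card V"
    by (subst card_Un_disjoint) (simp_all add: card_image)
  moreover have "card (V \<union> (+) v ` V) \<le> CARD('a)"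
    by (intro card_mono) simp_all
  moreover have "card W \<le> card V"
    using assms(3) by (intro card_mono) simp_all
  ultimately show ?thesis
    using W by linarith
qed simp

section \<open>Truncated power series\<close>

lemma fps_cutoff_cutoff: "n \<le> i \<Longrightarrow> fps_cutoff n (fps_cutoff i f) = fps_cutoff n f"
  by (simp add: fps_eq_iff)

lemma fps_cutoff_eq_self_iff: "fps_cutoff i f = f \<longleftrightarrow> (\<forall>k\<ge>i. fps_nth f k = 0)"
proof
  assume "fps_cutoff i f = f"
  then show "\<forall>k\<ge>i. fps_nth f k = 0"
    by (metis fps_cutoff_nth not_le)
next
  assume "\<forall>k\<ge>i. fps_nth f k = 0"
  then show "fps_cutoff i f = f"
    by (intro fps_ext) simp
qed

lemma fps_cutoff_mult_cong:
  fixes f g :: "'a::field fps"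
  assumes "fps_cutoff n f = fps_cutoff n f'" "fps_cutoff n g = fps_cutoff n g'"
  shows "fps_cutoff n (f * g) = fps_cutoff n (f' * g')"
  by (metis assms fps_cutoff_mult)

lemma fps_cutoff_add_cong:
  fixes f g :: "'a::field fps"
  assumes "fps_cutoff n f = fps_cutoff n f'" "fps_cutoff n g = fps_cutoff n g'"
  shows "fps_cutoff n (f + g) = fps_cutoff n (f' + g')"
  by (simp add: assms fps_cutoff_add)

lemma fps_cutoff_diff_cong:
  fixes f g :: "'a::field fps"
  assumes "fps_cutoff n f = fps_cutoff n f'" "fps_cutoff n g = fps_cutoff n g'"
  shows "fps_cutoff n (f - g) = fps_cutoff n (f' - g')"
  by (simp add: assms fps_cutoff_diff)

lemmas fps_cutoff_congs = fps_cutoff_mult_cong fps_cutoff_add_cong fps_cutoff_diff_cong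

lemma fps_cutoff_mult_cancel_unit:
  fixes f g u :: "'a::field fps"
  assumes "fps_nth u 0 \<noteq> 0" "fps_cutoff n (u * f) = fps_cutoff n (u * g)"
  shows "fps_cutoff n f = fps_cutoff n g"
proof -
  have u: "inverse u * (u * h) = h" for h
    using inverse_mult_eq_1[OF assms(1)] by (simp flip: mult.assoc)
  have "fps_cutoff n (inverse u * (u * f)) = fps_cutoff n (inverse u * (u * g))"
    by (intro fps_cutoff_mult_cong assms refl)
  then show ?thesis
    by (simp add: u)
qed

lemma fps_mult_nth_eq_0:
  fixes f g :: "'a::semiring_0 fps"
  assumes "\<And>j. j < w \<Longrightarrow> fps_nth f j = 0" "n < w"
  shows "fps_nth (f * g) n = 0"
  unfolding fps_mult_nth using assms by (intro sum.neutral) auto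

text \<open>The units congruent to 1 mod \<open>t\<^sup>n\<close> map homomorphically to their coefficients of \<open>t\<^sup>n\<close>.\<close>
lemma fps_mult_nth_one_mod:
  fixes F G :: "'a::field fps"
  assumes "fps_cutoff n F = fps_cutoff n 1" "fps_cutoff n G = fps_cutoff n 1" "0 < n"
  shows "fps_nth (F * G) n = fps_nth F n + fps_nth G n"
proof -
  have F: "F = 1 + fps_X ^ n * fps_shift n F" and G: "G = 1 + fps_X ^ n * fps_shift n G"
    using fps_shift_cutoff'[of n F] fps_shift_cutoff'[of n G] assms
    by (simp_all add: fps_cutoff_one add.commute)
  have "F * G = 1 + fps_X ^ n * (fps_shift n F + fps_shift n G
                 + fps_X ^ n * (fps_shift n F * fps_shift n G))"
    by (subst F, subst G) (simp add: algebra_simps)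
  then show ?thesis
    using assms(3) by (simp add: fps_X_power_mult_nth)
qed

lemma card_truncated_fps:
  "card {f :: 'a::{field,finite} fps. fps_cutoff i f = f} = CARD('a) ^ i"
proof -
  have "bij_betw (\<lambda>f. restrict (fps_nth f) {..<i}) {f :: 'a fps. fps_cutoff i f = f}
          ({..<i} \<rightarrow>\<^sub>E UNIV)"
  proof (rule bij_betw_byWitness[where f' = "\<lambda>g. Abs_fps (\<lambda>n. if n < i then g n else 0)"])
    show "\<forall>f\<in>{f :: 'a fps. fps_cutoff i f = f}.
        Abs_fps (\<lambda>n. if n < i then restrict (fps_nth f) {..<i} n else 0) = f"
    proof
      fix f :: "'a fps"
      assume "f \<in> {f. fps_cutoff i f = f}"
      then have "fps_cutoff i f = f" by simp
      moreover have "Abs_fps (\<lambda>n. if n < i then restrict (fps_nth f) {..<i} n else 0) = fps_cutoff i f"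
        by (rule fps_ext) simp
      ultimately show "Abs_fps (\<lambda>n. if n < i then restrict (fps_nth f) {..<i} n else 0) = f"
        by simp
    qed
    show "\<forall>g\<in>{..<i} \<rightarrow>\<^sub>E (UNIV :: 'a set).
        restrict (fps_nth (Abs_fps (\<lambda>n. if n < i then g n else 0))) {..<i} = g"
      by (simp add: restrict_def PiE_def extensional_def fun_eq_iff)
    show "(\<lambda>f. restrict (fps_nth f) {..<i}) ` {f :: 'a fps. fps_cutoff i f = f} \<subseteq> {..<i} \<rightarrow>\<^sub>E UNIV"
      by (intro image_subsetI restrict_PiE_iff[THEN iffD2] ballI UNIV_I)
    show "(\<lambda>g. Abs_fps (\<lambda>n. if n < i then g n else 0)) ` ({..<i} \<rightarrow>\<^sub>E (UNIV :: 'a set))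
        \<subseteq> {f. fps_cutoff i f = f}"
      by (intro image_subsetI CollectI fps_ext) simp
  qed
  then have "card {f :: 'a fps. fps_cutoff i f = f} = card ({..<i} \<rightarrow>\<^sub>E (UNIV :: 'a set))"
    by (rule bij_betw_same_card)
  then show ?thesis
    by (simp add: card_PiE)
qed

lemma finite_truncated_fps: "finite {f :: 'a::{field,finite} fps. fps_cutoff i f = f}"
  by (rule card_ge_0_finite) (simp add: card_truncated_fps)

lemma card_truncated_fps_nth_0:
  assumes "1 \<le> i"
  shows "card {f :: 'a::{field,finite} fps. fps_cutoff i f = f \<and> fps_nth f 0 = 1} = CARD('a) ^ (i - 1)"
proof -
  have "bij_betw (\<lambda>f. 1 + fps_X * f) {f :: 'a fps. fps_cutoff (i - 1) f = f}
          {f. fps_cutoff i f = f \<and> fps_nth f 0 = 1}"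
  proof (rule bij_betw_byWitness[where f' = "fps_shift 1"])
    show "\<forall>f\<in>{f :: 'a fps. fps_cutoff (i - 1) f = f}. fps_shift 1 (1 + fps_X * f) = f"
      by (intro ballI fps_ext) (simp add: fps_X_mult_nth)
    show "\<forall>f\<in>{f :: 'a fps. fps_cutoff i f = f \<and> fps_nth f 0 = 1}. 1 + fps_X * fps_shift 1 f = f"
      by (intro ballI fps_ext) (simp add: fps_X_mult_nth)
    show "(\<lambda>f. 1 + fps_X * f) ` {f :: 'a fps. fps_cutoff (i - 1) f = f}
        \<subseteq> {f. fps_cutoff i f = f \<and> fps_nth f 0 = 1}"
      using assms by (intro image_subsetI) (simp add: fps_cutoff_eq_self_iff fps_X_mult_nth)
    show "fps_shift 1 ` {f :: 'a fps. fps_cutoff i f = f \<and> fps_nth f 0 = 1}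
        \<subseteq> {f. fps_cutoff (i - 1) f = f}"
      using assms by (intro image_subsetI) (simp add: fps_cutoff_eq_self_iff)
  qed
  from bij_betw_same_card[OF this] show ?thesis
    by (simp add: card_truncated_fps)
qed

section \<open>The norm form and its filtration\<close>

text \<open>
  The norm of \<open>x + y \<theta>\<close> for a root \<open>\<theta>\<close> of \<open>X\<^sup>2 - T X + D\<close>.
\<close>
definition norm_form :: "'a::comm_ring_1 \<Rightarrow> 'a \<Rightarrow> 'a \<times> 'a \<Rightarrow> 'a" where
  "norm_form T D = (\<lambda>(x, y). x\<^sup>2 + T * x * y + D * y\<^sup>2)"

text \<open>
  The product of \<open>x + y \<theta>\<close> and \<open>a + b \<theta>\<close>, where \<open>\<theta>\<^sup>2 = T \<theta> - D\<close>, with its coordinates reduced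
  mod \<open>t\<^sup>i\<close>.
\<close>
definition trunc_mult ::
  "'a::field fps \<Rightarrow> 'a fps \<Rightarrow> nat \<Rightarrow> 'a fps \<times> 'a fps \<Rightarrow> 'a fps \<times> 'a fps \<Rightarrow> 'a fps \<times> 'a fps" where
  "trunc_mult T D i = (\<lambda>(x, y) (a, b).
     (fps_cutoff i (x * a - D * y * b), fps_cutoff i (x * b + y * a + T * y * b)))"

text \<open>
  The pairs over \<open>\<O>\<^sub>i\<close>, given by truncated representatives, whose norm is 1 mod \<open>t\<^sup>n\<close>; for \<open>n \<le> i\<close>
  this does not depend on the choice of the representatives.
\<close>
definition norm_one_pairs :: "'a::field fps \<Rightarrow> 'a fps \<Rightarrow> nat \<Rightarrow> nat \<Rightarrow> ('a fps \<times> 'a fps) set" where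
  "norm_one_pairs T D i n = {(x, y). fps_cutoff i x = x \<and> fps_cutoff i y = y \<and>
     fps_cutoff n (norm_form T D (x, y)) = fps_cutoff n 1}"

lemma norm_form_mult:
  "norm_form T D (x * a - D * y * b, x * b + y * a + T * y * b)
     = norm_form T D (x, y) * norm_form T D (a, b)"
  by (simp add: norm_form_def power2_eq_square algebra_simps)

lemma fps_cutoff_norm_form_trunc:
  fixes T D :: "'a::field fps"
  assumes "n \<le> i"
  shows "fps_cutoff n (norm_form T D (fps_cutoff i x, fps_cutoff i y))
         = fps_cutoff n (norm_form T D (x, y))"
  unfolding norm_form_def power2_eq_square prod.case
  by (intro fps_cutoff_congs refl fps_cutoff_cutoff assms)

lemma fps_cutoff_norm_form_trunc_mult:
  fixes T D :: "'a::field fps"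
  assumes "n \<le> i"
  shows "fps_cutoff n (norm_form T D (trunc_mult T D i p s))
         = fps_cutoff n (norm_form T D p * norm_form T D s)"
  by (cases p; cases s)
    (simp add: trunc_mult_def fps_cutoff_norm_form_trunc[OF assms] norm_form_mult)

lemma finite_norm_one_pairs: "finite (norm_one_pairs T D i n :: ('a::{field,finite} fps \<times> 'a fps) set)"
  by (rule finite_subset[of _ "{f. fps_cutoff i f = f} \<times> {f. fps_cutoff i f = f}"])
    (auto simp: norm_one_pairs_def finite_truncated_fps)

lemma trunc_mult_in_norm_one_pairs:
  assumes "n \<le> i" "p \<in> norm_one_pairs T D i n" "s \<in> norm_one_pairs T D i n"
  shows "trunc_mult T D i p s \<in> norm_one_pairs T D i n"
proof -
  have "fps_cutoff n (norm_form T D (trunc_mult T D i p s)) = fps_cutoff n (1 * 1)"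
    unfolding fps_cutoff_norm_form_trunc_mult[OF assms(1)]
    using assms(2,3) by (intro fps_cutoff_mult_cong) (auto simp: norm_one_pairs_def)
  then show ?thesis
    by (auto simp: norm_one_pairs_def trunc_mult_def fps_cutoff_idem split: prod.splits)
qed

lemma inj_on_trunc_mult:
  assumes "0 < n" and p: "p \<in> norm_one_pairs T D i n"
  shows "inj_on (trunc_mult T D i p) (norm_one_pairs T D i m)"
proof (rule inj_onI)
  fix s s' assume s: "s \<in> norm_one_pairs T D i m" "s' \<in> norm_one_pairs T D i m"
    and eq: "trunc_mult T D i p s = trunc_mult T D i p s'"
  obtain x y a b a' b' where [simp]: "p = (x, y)" "s = (a, b)" "s' = (a', b')"
    by (cases p; cases s; cases s')
  let ?N = "norm_form T D (x, y)"
  have N: "fps_nth ?N 0 \<noteq> 0"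
  proof -
    have "fps_nth (fps_cutoff n ?N) 0 = fps_nth (fps_cutoff n 1) 0"
      using p by (simp add: norm_one_pairs_def)
    then show ?thesis using assms(1) by simp
  qed
  have e1: "fps_cutoff i (x * a - D * y * b) = fps_cutoff i (x * a' - D * y * b')"
    and e2: "fps_cutoff i (x * b + y * a + T * y * b) = fps_cutoff i (x * b' + y * a' + T * y * b')"
    using eq by (auto simp: trunc_mult_def)
  \<comment> \<open>Multiplying the product by the conjugate \<open>(x + T y) - y \<theta>\<close> of the left factor gives its norm.\<close>
  have a: "?N * a = (x + T * y) * (x * a - D * y * b) + D * y * (x * b + y * a + T * y * b)"
    and b: "?N * b = x * (x * b + y * a + T * y * b) - y * (x * a - D * y * b)" for a b
    by (simp_all add: norm_form_def power2_eq_square algebra_simps)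
  have "fps_cutoff i (?N * a) = fps_cutoff i (?N * a')" "fps_cutoff i (?N * b) = fps_cutoff i (?N * b')"
    unfolding a[of a b] a[of a' b'] b[of b a] b[of b' a']
    by (rule fps_cutoff_add_cong[OF fps_cutoff_mult_cong[OF refl e1] fps_cutoff_mult_cong[OF refl e2]],
        rule fps_cutoff_diff_cong[OF fps_cutoff_mult_cong[OF refl e2] fps_cutoff_mult_cong[OF refl e1]])
  then have "fps_cutoff i a = fps_cutoff i a'" "fps_cutoff i b = fps_cutoff i b'"
    using fps_cutoff_mult_cancel_unit[OF N] by blast+
  then show "s = s'"
    using s by (auto simp: norm_one_pairs_def)
qed

lemma norm_one_pairs_hom:
  assumes "n < i" "0 < n" "p \<in> norm_one_pairs T D i n" "s \<in> norm_one_pairs T D i n"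
  shows "fps_nth (norm_form T D (trunc_mult T D i p s)) n
         = fps_nth (norm_form T D p) n + fps_nth (norm_form T D s) n"
proof -
  have "fps_cutoff (Suc n) (norm_form T D (trunc_mult T D i p s))
        = fps_cutoff (Suc n) (norm_form T D p * norm_form T D s)"
    using assms(1) by (intro fps_cutoff_norm_form_trunc_mult) simp
  then have "fps_nth (norm_form T D (trunc_mult T D i p s)) n
        = fps_nth (norm_form T D p * norm_form T D s) n"
    by (simp add: fps_cutoff_eq_fps_cutoff_iff)
  then show ?thesis
    using assms by (auto simp: norm_one_pairs_def fps_mult_nth_one_mod)
qed

text \<open>
  The image of the \<open>n\<close>-th layer of the filtration in the residue field: all coefficients of \<open>t\<^sup>n\<close>
  of norms that are 1 mod \<open>t\<^sup>n\<close>.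
\<close>
definition norm_layer :: "'a::field fps \<Rightarrow> 'a fps \<Rightarrow> nat \<Rightarrow> nat \<Rightarrow> 'a set" where
  "norm_layer T D i n = (\<lambda>s. fps_nth (norm_form T D s) n) ` norm_one_pairs T D i n"

lemma norm_layer_add:
  assumes "n < i" "0 < n" "u \<in> norm_layer T D i n" "v \<in> norm_layer T D i n"
  shows "u + v \<in> norm_layer T D i n"
proof -
  obtain p s where "p \<in> norm_one_pairs T D i n" "u = fps_nth (norm_form T D p) n"
    "s \<in> norm_one_pairs T D i n" "v = fps_nth (norm_form T D s) n"
    using assms(3,4) unfolding norm_layer_def by blast
  then show ?thesis
    unfolding norm_layer_def
    using assms(1,2) norm_one_pairs_hom[of n i p T D s] trunc_mult_in_norm_one_pairs[of n i p T D s]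
    by (intro image_eqI[where x = "trunc_mult T D i p s"]) auto
qed

lemma card_norm_one_pairs_step:
  fixes T D :: "'a::{field,finite} fps"
  assumes "CHAR('a) = 2" "n < i" "0 < n"
  shows "card (norm_one_pairs T D i n) = card (norm_one_pairs T D i (Suc n)) * card (norm_layer T D i n)"
proof -
  have "{s \<in> norm_one_pairs T D i n. fps_nth (norm_form T D s) n = 0} = norm_one_pairs T D i (Suc n)"
    using assms(3) by (auto simp: norm_one_pairs_def fps_cutoff_eq_fps_cutoff_iff less_Suc_eq)
  moreover have "card (norm_one_pairs T D i n)
      = card {s \<in> norm_one_pairs T D i n. fps_nth (norm_form T D s) n = 0} * card (norm_layer T D i n)"
    unfolding norm_layer_def
    by (rule card_eq_kernel_times_image_CHAR_2[where m = "trunc_mult T D i"])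
      (use assms in \<open>auto intro: finite_norm_one_pairs trunc_mult_in_norm_one_pairs
        norm_one_pairs_hom inj_on_trunc_mult\<close>)
  ultimately show ?thesis
    by simp
qed

section \<open>The layers of the norm form of a matrix of given odd depth\<close>

text \<open>
  The coefficients \<open>T\<close>, \<open>D\<close> of the norm form after the shift by \<open>d\<close>. Modulo \<open>t\<^sup>i\<close>, the series \<open>T\<close> has
  valuation \<open>w\<close>, where \<open>w = i\<close> stands for \<open>T = 0\<close>. In the first case of \<open>D_cases\<close> the odd depth \<open>\<delta>\<close>
  is less than \<open>\<lfloor>w/2\<rfloor>\<close>; in the second it equals \<open>\<lfloor>w/2\<rfloor>\<close>.
\<close>
locale depth_form =
  fixes T D :: "'a::{field,finite} fps" and i w \<delta> :: nat
  assumes char2: "CHAR('a) = 2"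
    and w_pos: "1 \<le> w" and w_le: "w \<le> i"
    and T_low: "\<And>j. j < w \<Longrightarrow> fps_nth T j = 0"
    and T_w: "w < i \<Longrightarrow> fps_nth T w \<noteq> 0"
    and depth_le: "2 * \<delta> \<le> w"
    and D_cases: "2 * \<delta> + 1 < w \<and> D \<noteq> 0 \<and> subdegree D = 2 * \<delta> + 1
      \<or> w \<le> 2 * \<delta> + 1 \<and> (\<forall>j<w. fps_nth D j = 0)"
begin

lemma D_low: "j < 2 * \<delta> + 1 \<Longrightarrow> j < w \<Longrightarrow> fps_nth D j = 0"
  using D_cases nth_less_subdegree_zero[of j D] by auto

lemma T_0: "fps_nth T 0 = 0" and D_0: "fps_nth D 0 = 0"
  using T_low[of 0] D_low[of 0] w_pos by auto

lemma card_norm_one_pairs_1: "card (norm_one_pairs T D i 1) = CARD('a) ^ (2 * i - 1)"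
proof -
  let ?A = "{f :: 'a fps. fps_cutoff i f = f \<and> fps_nth f 0 = 1}"
    and ?B = "{f :: 'a fps. fps_cutoff i f = f}"
  have i: "1 \<le> i" using w_pos w_le by simp
  have sq: "c\<^sup>2 = 1 \<longleftrightarrow> c = 1" for c :: 'a
    using minus_CHAR_2[OF char2, of 0 1] by (auto simp: power2_eq_1_iff)
  have "fps_nth (norm_form T D (x, y)) 0 = (fps_nth x 0)\<^sup>2" for x y
    by (simp add: norm_form_def T_0 D_0 power2_eq_square)
  then have "norm_one_pairs T D i 1 = ?A \<times> ?B"
    by (auto simp: norm_one_pairs_def fps_cutoff_eq_fps_cutoff_iff sq)
  then have "card (norm_one_pairs T D i 1) = CARD('a) ^ (i - 1) * CARD('a) ^ i"
    using card_truncated_fps_nth_0[OF i, where 'a = 'a] card_truncated_fps[of i, where 'a = 'a]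
    by (simp add: card_cartesian_product)
  also have "\<dots> = CARD('a) ^ (i - 1 + i)"
    by (simp add: power_add)
  also have "i - 1 + i = 2 * i - 1"
    using i by simp
  finally show ?thesis .
qed

lemma norm_layerI:
  assumes "norm_form T D (x, y) = F" "fps_cutoff i x = x" "fps_cutoff i y = y"
    "fps_cutoff n F = fps_cutoff n 1" "fps_nth F n = v"
  shows "v \<in> norm_layer T D i n"
  unfolding norm_layer_def using assms
  by (intro image_eqI[where x = "(x, y)"]) (auto simp: norm_one_pairs_def)

lemma norm_layer_even:
  assumes "even n" "0 < n" "n < i"
  shows "norm_layer T D i n = UNIV"
proof -
  obtain k where k: "n = 2 * k" "0 < k"
    using assms(1,2) by auto
  have "v \<in> norm_layer T D i n" for v
  proof -
    obtain s where s: "s\<^sup>2 = v"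
      using ex_sqrt_CHAR_2[OF char2] by blast
    have "norm_form T D (1 + fps_const s * fps_X ^ k, 0) = 1 + fps_const v * fps_X ^ n"
      unfolding norm_form_def k(1) s[symmetric]
      by (simp add: square_add_CHAR_2 char2 power_mult_distrib mult.commute flip: power_mult fps_const_power)
    then show ?thesis
      by (rule norm_layerI) (use assms k in \<open>auto simp: fps_cutoff_eq_self_iff fps_cutoff_eq_fps_cutoff_iff
         fps_X_power_iff fps_one_nth\<close>)
  qed
  then show ?thesis by blast
qed

lemma norm_layer_odd_low:
  assumes "odd n" "n < 2 * \<delta>" "n < i"
  shows "norm_layer T D i n = {0}"
proof -
  have n: "n < w" "0 < n" using assms depth_le by (auto intro: odd_pos)
  have "fps_nth (norm_form T D (x, y)) n = 0" for x y
  proof -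
    have "fps_nth (T * (x * y)) n = 0" "fps_nth (D * y\<^sup>2) n = 0"
      by (rule fps_mult_nth_eq_0[of w], use n T_low in auto)
         (rule fps_mult_nth_eq_0[of "2 * \<delta>"], use assms D_low depth_le in auto)
    then show ?thesis
      using assms(1) by (simp add: norm_form_def fps_square_nth_CHAR_2 char2 mult.assoc)
  qed
  moreover have "(1, 0) \<in> norm_one_pairs T D i n"
    using assms by (simp add: norm_one_pairs_def norm_form_def fps_cutoff_one)
  ultimately show ?thesis
    unfolding norm_layer_def by force
qed

text \<open>
  The norm of \<open>(1, c t\<^sup>k)\<close> is \<open>1 + c t\<^sup>k T + c\<^sup>2 t\<^bsup>2k\<^esup> D\<close>; the hypotheses make it 1 mod \<open>t\<^sup>n\<close>.
\<close>
lemma norm_layer_monomial: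
  assumes "k \<le> n" "k < i" "0 < n"
    and T: "\<And>j. j + k < n \<Longrightarrow> fps_nth T j = 0"
    and D: "\<And>j. j + 2 * k < n \<Longrightarrow> fps_nth D j = 0"
  shows "fps_nth T (n - k) * c + (if 2 * k \<le> n then fps_nth D (n - 2 * k) else 0) * c\<^sup>2
         \<in> norm_layer T D i n"
proof -
  let ?F = "1 + (fps_X ^ k * (fps_const c * T) + fps_X ^ (2 * k) * (fps_const (c\<^sup>2) * D))"
  have F: "norm_form T D (1, fps_const c * fps_X ^ k) = ?F"
    unfolding norm_form_def
    by (simp add: power_mult_distrib mult_ac flip: power_mult fps_const_power)
  show ?thesis
  proof (rule norm_layerI[OF F])
    show "fps_cutoff i 1 = (1 :: 'a fps)"
      using assms by (simp add: fps_cutoff_one)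
    show "fps_cutoff i (fps_const c * fps_X ^ k) = fps_const c * fps_X ^ k"
      using assms by (simp add: fps_cutoff_eq_self_iff fps_X_power_iff)
    have "fps_nth (fps_X ^ k * (fps_const c * T) + fps_X ^ (2 * k) * (fps_const (c\<^sup>2) * D)) j = 0"
      if "j < n" for j
      using that T[of "j - k"] D[of "j - 2 * k"] by (simp add: fps_X_power_mult_nth)
    then show "fps_cutoff n ?F = fps_cutoff n 1"
      by (simp add: fps_cutoff_eq_fps_cutoff_iff)
    show "fps_nth ?F n = fps_nth T (n - k) * c + (if 2 * k \<le> n then fps_nth D (n - 2 * k) else 0) * c\<^sup>2"
      using assms(1,3) by (simp add: fps_X_power_mult_nth)
  qed
qed

text \<open>
  With \<open>v\<close> the valuation of \<open>D\<close>, the coefficient at \<open>n\<close> comes from the term \<open>D y\<^sup>2\<close> for \<open>n < 2w - v\<close>,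
  from \<open>T x y\<close> for \<open>n > 2w - v\<close>, and from both for \<open>n = 2w - v\<close>.
\<close>
lemma norm_layer_odd_high:
  assumes "odd n" "2 * \<delta> < n" "n < i"
  shows "card (norm_layer T D i n) = CARD('a)
    \<or> (2 * card (norm_layer T D i n) = CARD('a) \<and> D \<noteq> 0 \<and> n + subdegree D = 2 * w)"
proof -
  have n0: "0 < n" using assms(2) by simp
  have linear: "norm_layer T D i n = UNIV" if "a \<noteq> 0" "\<And>c. a * c \<in> norm_layer T D i n" for a
    using that(2)[of "x / a" for x] that(1) by (metis UNIV_eq_I nonzero_mult_div_cancel_left times_divide_eq_right)
  show ?thesis
  proof (cases "2 * \<delta> + 1 < w \<and> n + (2 * \<delta> + 1) < 2 * w")
    case True
    then have D: "D \<noteq> 0" "subdegree D = 2 * \<delta> + 1"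
      using D_cases by auto
    have "\<exists>k. n = 2 * k + (2 * \<delta> + 1)"
      using assms(1,2) by presburger
    then obtain k where k: "n = 2 * k + (2 * \<delta> + 1)" ..
    \<comment> \<open>The quadratic term dominates: \<open>t\<^bsup>2k\<^esup> D\<close> starts at \<open>n\<close>, and \<open>t\<^sup>k T\<close> starts later.\<close>
    have dm: "fps_nth D (2 * \<delta> + 1) \<noteq> 0"
      using D by (metis nth_subdegree_nonzero)
    have "fps_nth T (n - k) * c + (if 2 * k \<le> n then fps_nth D (n - 2 * k) else 0) * c\<^sup>2
         \<in> norm_layer T D i n" for c
      using True k assms D by (intro norm_layer_monomial T_low D_low) auto
    moreover have "fps_nth T (n - k) = 0"
      using True k by (intro T_low) auto
    ultimately have quadratic: "fps_nth D (2 * \<delta> + 1) * c\<^sup>2 \<in> norm_layer T D i n" for c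
      using k by simp
    have "fps_nth D (2 * \<delta> + 1) * c \<in> norm_layer T D i n" for c
      using quadratic ex_sqrt_CHAR_2[OF char2, of c] by metis
    then show ?thesis
      using linear[OF dm] by simp
  next
    case False
    then have wn: "w \<le> n"
      using assms depth_le by linarith
    \<comment> \<open>Now \<open>t\<^sup>k T\<close> starts at \<open>n\<close>, and \<open>t\<^bsup>2k\<^esup> D\<close> not before.\<close>
    define k where "k = n - w"
    have k: "n - k = w" "k \<le> n" using wn by (auto simp: k_def)
    have Tw: "fps_nth T w \<noteq> 0"
      using wn assms(3) T_w by simp
    have Dj: "fps_nth D j = 0" if "j + 2 * k < n" for j
      using D_cases
    proof (elim disjE conjE)
      assume "2 * \<delta> + 1 < w" "subdegree D = 2 * \<delta> + 1"
      then show ?thesis using False that wn by (intro nth_less_subdegree_zero) (auto simp: k_def)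
    next
      assume "\<forall>j<w. fps_nth D j = 0"
      then show ?thesis using that wn by (auto simp: k_def)
    qed
    define d where "d = (if 2 * k \<le> n then fps_nth D (n - 2 * k) else 0)"
    have *: "fps_nth T w * c + d * c\<^sup>2 \<in> norm_layer T D i n" for c
      using norm_layer_monomial[of k n c] k assms n0 Dj T_low unfolding d_def by auto
    show ?thesis
    proof (cases "d = 0")
      case True
      then show ?thesis
        using linear[OF Tw] * by simp
    next
      case d: False
      then have kn: "2 * k \<le> n" "fps_nth D (n - 2 * k) \<noteq> 0"
        by (auto simp: d_def split: if_splits)
      then have "subdegree D = n - 2 * k"
        using Dj by (intro subdegreeI) auto
      then have "D \<noteq> 0 \<and> n + subdegree D = 2 * w"
        using kn wn by (auto simp: k_def)
      moreover have "range (\<lambda>c. fps_nth T w * c + d * c\<^sup>2) \<subseteq> norm_layer T D i n"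
        using * by blast
      then have "card (norm_layer T D i n) = CARD('a) \<or> 2 * card (norm_layer T D i n) = CARD('a)"
        using card_artin_schreier_image[OF char2 Tw d] norm_layer_add[OF assms(3) n0]
        by (intro card_add_closed_CHAR_2[OF char2]) auto
      ultimately show ?thesis by blast
    qed
  qed
qed

text \<open>
  Among the indices from 1 to \<open>n\<close>, the odd ones below \<open>2\<delta>\<close> have trivial layer; they are
  \<open>min \<delta> \<lfloor>(n+1)/2\<rfloor>\<close> in number. The last clause records that the factor 2 arises at most once, at
  the index \<open>2w - v\<close> with \<open>v\<close> the valuation of \<open>D\<close>.
\<close>
lemma card_norm_one_pairs_filtration:
  "n < i \<Longrightarrow> \<exists>c\<in>{1, 2}. card (norm_one_pairs T D i (Suc n)) * CARD('a) ^ n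
       = c * CARD('a) ^ (2 * i - 1 + min \<delta> (Suc n div 2))
     \<and> (c = 1 \<or> D \<noteq> 0 \<and> 2 * w \<le> n + subdegree D)"
proof (induction n)
  case 0
  then show ?case
    using card_norm_one_pairs_1 by simp
next
  case (Suc n)
  let ?q = "CARD('a)" and ?S = "\<lambda>n. card (norm_one_pairs T D i n)" and ?v = "card (norm_layer T D i (Suc n))"
  from Suc obtain c where c: "c \<in> {1, 2}" and
    IH: "?S (Suc n) * ?q ^ n = c * ?q ^ (2 * i - 1 + min \<delta> (Suc n div 2))"
    and c1: "c = 1 \<or> D \<noteq> 0 \<and> 2 * w \<le> n + subdegree D"
    by auto
  have step: "?S (Suc n) = ?S (Suc (Suc n)) * ?v"
    using Suc.prems by (intro card_norm_one_pairs_step char2) auto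
  consider (low) "odd (Suc n)" "Suc n < 2 * \<delta>" | (full) "even (Suc n) \<or> 2 * \<delta> < Suc n" "?v = ?q"
    | (half) "odd (Suc n)" "2 * \<delta> < Suc n" "2 * ?v = ?q" "D \<noteq> 0" "Suc n + subdegree D = 2 * w"
  proof (cases "even (Suc n)")
    case True
    then show thesis
      using norm_layer_even Suc.prems full by simp
  next
    case False
    then have "Suc n < 2 * \<delta> \<or> 2 * \<delta> < Suc n"
      by presburger
    then show thesis
      using norm_layer_odd_high[of "Suc n"] Suc.prems False low full half by blast
  qed
  then show ?case
  proof cases
    case low
    then have "?v = 1"
      using norm_layer_odd_low Suc.prems by simp
    moreover have "min \<delta> (Suc (Suc n) div 2) = Suc (min \<delta> (Suc n div 2))"
      using low by presburger
    ultimately show ?thesis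
      using IH step c c1 by (intro bexI[of _ c]) auto
  next
    case full
    have "min \<delta> (Suc (Suc n) div 2) = min \<delta> (Suc n div 2)"
      using full(1) by presburger
    then show ?thesis
      using IH step c c1 full(2) by (intro bexI[of _ c]) (auto simp: mult_ac)
  next
    case half
    have "min \<delta> (Suc (Suc n) div 2) = min \<delta> (Suc n div 2)"
      using half(2) by presburger
    moreover have "c = 1"
      using c1 half by auto
    ultimately have "?S (Suc (Suc n)) * ?v * ?q ^ n = ?q ^ (2 * i - 1 + min \<delta> (Suc (Suc n) div 2))"
      using IH step by simp
    then have "?S (Suc (Suc n)) * (2 * ?v) * ?q ^ n = 2 * ?q ^ (2 * i - 1 + min \<delta> (Suc (Suc n) div 2))"
      by simp
    then show ?thesis
      using half by (intro bexI[of _ 2]) (auto simp: mult_ac)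
  qed
qed

lemma card_norm_one_pairs:
  "\<exists>c\<in>{1, 2}. card (norm_one_pairs T D i i) = c * CARD('a) ^ (i + \<delta>)"
proof -
  obtain n where n: "i = Suc n"
    using w_pos w_le by (cases i) auto
  obtain c where c: "c \<in> {1, 2}"
    "card (norm_one_pairs T D i i) * CARD('a) ^ n = c * CARD('a) ^ (2 * i - 1 + min \<delta> (i div 2))"
    using card_norm_one_pairs_filtration[of n] n by auto
  have "\<delta> \<le> i div 2"
    using depth_le w_le by linarith
  then have "2 * i - 1 + min \<delta> (i div 2) = i + \<delta> + n"
    using n by (simp add: min_def)
  then have "card (norm_one_pairs T D i i) * CARD('a) ^ n = c * CARD('a) ^ (i + \<delta>) * CARD('a) ^ n"
    using c(2) by (simp add: power_add)
  moreover have "CARD('a) ^ n \<noteq> 0"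
    by simp
  ultimately have "card (norm_one_pairs T D i i) = c * CARD('a) ^ (i + \<delta>)"
    using mult_right_cancel by blast
  with c(1) show ?thesis by blast
qed

end

section \<open>The commutant of a matrix that is not scalar mod \<open>t\<close>\<close>

text \<open>
  The entrywise form of \<open>g A \<equiv> A g\<close> for \<open>A = (a, b; c, e)\<close> and \<open>g = (p, q; r, s)\<close>: if \<open>b\<close> is a unit,
  then \<open>g\<close> is congruent to a scalar matrix plus \<open>y A\<close> with \<open>y = q/b\<close>.
\<close>
lemma commutant_entries_offdiagonal:
  fixes a b c e p q r s :: "'a::field fps"
  assumes "fps_nth b 0 \<noteq> 0"
    and 12: "fps_cutoff i (p * b + q * e) = fps_cutoff i (a * q + b * s)"
    and 11: "fps_cutoff i (p * a + q * c) = fps_cutoff i (a * p + b * r)"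
  shows "\<exists>y. fps_cutoff i q = fps_cutoff i (y * b) \<and> fps_cutoff i r = fps_cutoff i (y * c)
    \<and> fps_cutoff i (p - s) = fps_cutoff i (y * (a - e))"
proof (intro exI conjI)
  let ?y = "q * inverse b"
  have yb: "?y * b = q"
    using inverse_mult_eq_1[OF assms(1)] by (simp add: mult.assoc)
  have bm: "b * (?y * z) = q * z" for z
    using yb by (metis mult.assoc mult.commute)
  show "fps_cutoff i q = fps_cutoff i (?y * b)"
    by (simp only: yb)
  have "fps_cutoff i (b * r) = fps_cutoff i (b * (?y * c))"
    unfolding bm using 11 by (simp add: fps_cutoff_add mult.commute)
  then show "fps_cutoff i r = fps_cutoff i (?y * c)"
    by (rule fps_cutoff_mult_cancel_unit[OF assms(1)])
  have "fps_cutoff i (b * (p - s)) = fps_cutoff i (b * (?y * (a - e)))"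
    unfolding bm using 12 by (simp add: fps_cutoff_add fps_cutoff_diff algebra_simps)
  then show "fps_cutoff i (p - s) = fps_cutoff i (?y * (a - e))"
    by (rule fps_cutoff_mult_cancel_unit[OF assms(1)])
qed

lemma commutant_entries:
  fixes A g :: "'a::field fps ^ 2 ^ 2"
  assumes nonscalar: "fps_nth (A $ 1 $ 2) 0 \<noteq> 0 \<or> fps_nth (A $ 2 $ 1) 0 \<noteq> 0"
    and comm: "red i (g ** A) = red i (A ** g)"
  shows "\<exists>y. fps_cutoff i (g $ 1 $ 2) = fps_cutoff i (y * A $ 1 $ 2)
    \<and> fps_cutoff i (g $ 2 $ 1) = fps_cutoff i (y * A $ 2 $ 1)
    \<and> fps_cutoff i (g $ 1 $ 1 - g $ 2 $ 2) = fps_cutoff i (y * (A $ 1 $ 1 - A $ 2 $ 2))"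
proof -
  have entry: "fps_cutoff i ((g ** A) $ j $ k) = fps_cutoff i ((A ** g) $ j $ k)" for j k
    using comm by (simp add: red_def vec_eq_iff)
  from nonscalar show ?thesis
  proof
    assume "fps_nth (A $ 1 $ 2) 0 \<noteq> 0"
    then show ?thesis
      by (rule commutant_entries_offdiagonal)
        (use entry[of 1 2] entry[of 1 1] in \<open>simp_all add: matrix_matrix_mult_def sum_2\<close>)
  next
    \<comment> \<open>Exchanging the two basis vectors reduces this to the other case.\<close>
    assume "fps_nth (A $ 2 $ 1) 0 \<noteq> 0"
    then have "\<exists>y. fps_cutoff i (g $ 2 $ 1) = fps_cutoff i (y * A $ 2 $ 1)
      \<and> fps_cutoff i (g $ 1 $ 2) = fps_cutoff i (y * A $ 1 $ 2)
      \<and> fps_cutoff i (g $ 2 $ 2 - g $ 1 $ 1) = fps_cutoff i (y * (A $ 2 $ 2 - A $ 1 $ 1))"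
      by (rule commutant_entries_offdiagonal)
        (use entry[of 2 1] entry[of 2 2] in \<open>simp_all add: matrix_matrix_mult_def sum_2 add.commute\<close>)
    then obtain y where y: "fps_cutoff i (g $ 2 $ 1) = fps_cutoff i (y * A $ 2 $ 1)"
      "fps_cutoff i (g $ 1 $ 2) = fps_cutoff i (y * A $ 1 $ 2)"
      "fps_cutoff i (g $ 2 $ 2 - g $ 1 $ 1) = fps_cutoff i (y * (A $ 2 $ 2 - A $ 1 $ 1))"
      by blast
    have "fps_cutoff i (0 - (g $ 2 $ 2 - g $ 1 $ 1)) = fps_cutoff i (0 - y * (A $ 2 $ 2 - A $ 1 $ 1))"
      by (intro fps_cutoff_diff_cong refl y)
    then have "fps_cutoff i (g $ 1 $ 1 - g $ 2 $ 2) = fps_cutoff i (y * (A $ 1 $ 1 - A $ 2 $ 2))"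
      by (simp add: algebra_simps)
    with y show ?thesis by blast
  qed
qed

section \<open>The centraliser in \<open>SL\<^sub>2\<close>\<close>

lemma M2_mult: "A \<otimes>\<^bsub>M2 i\<^esub> B = red i (A ** B)"
  and M2_one: "\<one>\<^bsub>M2 i\<^esub> = red i (mat 1)"
  by (simp_all add: M2_def)

lemma SL2_subset_GL2: "SL2 i \<subseteq> (GL2 i :: ('a::field fps ^ 2 ^ 2) set)"
proof
  fix g :: "'a fps ^ 2 ^ 2"
  assume "g \<in> SL2 i"
  then have g: "g \<in> carrier (M2 i)" and det: "fps_cutoff i (det g) = fps_cutoff i 1"
    by (simp_all add: SL2_def det_Oi_def Oi_def)
  define adj :: "'a fps ^ 2 ^ 2" where
    "adj = vector [vector [g $ 2 $ 2, - g $ 1 $ 2], vector [- g $ 2 $ 1, g $ 1 $ 1]]"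
  have entries: "adj $ 1 $ 1 = g $ 2 $ 2" "adj $ 1 $ 2 = - g $ 1 $ 2"
    "adj $ 2 $ 1 = - g $ 2 $ 1" "adj $ 2 $ 2 = g $ 1 $ 1"
    by (simp_all add: adj_def)
  have "g ** adj = mat (det g)" "adj ** g = mat (det g)"
    by (simp_all add: vec_eq_iff forall_2 matrix_matrix_mult_def sum_2 entries mat_def det_2 algebra_simps)
  moreover have "red i (mat (det g)) = red i (mat 1 :: 'a fps ^ 2 ^ 2)"
    using det by (simp add: red_def vec_eq_iff mat_def)
  moreover have "red i g = g"
    using g by (simp only: in_M2_iff)
  ultimately have "g \<otimes>\<^bsub>M2 i\<^esub> red i adj = \<one>\<^bsub>M2 i\<^esub>" "red i adj \<otimes>\<^bsub>M2 i\<^esub> g = \<one>\<^bsub>M2 i\<^esub>"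
    unfolding M2_mult M2_one using red_mult[of i g adj] red_mult[of i adj g] by simp_all
  moreover have "red i adj \<in> carrier (M2 i)"
    unfolding in_M2_iff by (rule red_idem)
  ultimately show "g \<in> GL2 i"
    unfolding GL2_def Units_def using g by blast
qed

lemma centraliser_GL2_iff_commute:
  fixes A :: "'a::field fps ^ 2 ^ 2"
  assumes A: "A \<in> carrier (M2 i)"
  shows "g \<in> centraliser_GL2 i A \<longleftrightarrow> g \<in> GL2 i \<and> red i (g ** A) = red i (A ** g)"
proof -
  interpret ring "M2 i :: ('a fps ^ 2 ^ 2) ring"
    by (rule ring_M2)
  have "conj_M2 i g A = A \<longleftrightarrow> g \<otimes>\<^bsub>M2 i\<^esub> A = A \<otimes>\<^bsub>M2 i\<^esub> g" if g: "g \<in> Units (M2 i)"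
  proof
    assume "conj_M2 i g A = A"
    then have "A \<otimes>\<^bsub>M2 i\<^esub> g = g \<otimes>\<^bsub>M2 i\<^esub> A \<otimes>\<^bsub>M2 i\<^esub> inv\<^bsub>M2 i\<^esub> g \<otimes>\<^bsub>M2 i\<^esub> g"
      by (simp only: conj_M2_def)
    also have "\<dots> = g \<otimes>\<^bsub>M2 i\<^esub> A"
      using A g by (simp only: m_assoc m_closed Units_closed Units_inv_closed Units_l_inv r_one)
    finally show "g \<otimes>\<^bsub>M2 i\<^esub> A = A \<otimes>\<^bsub>M2 i\<^esub> g" by simp
  next
    assume "g \<otimes>\<^bsub>M2 i\<^esub> A = A \<otimes>\<^bsub>M2 i\<^esub> g"
    then show "conj_M2 i g A = A"
      using A g by (simp only: conj_M2_def m_assoc m_closed Units_closed Units_inv_closed Units_r_inv r_one)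
  qed
  then show ?thesis
    by (auto simp: centraliser_GL2_def GL2_def M2_mult)
qed

lemma centraliser_SL2_eq:
  fixes A :: "'a::field fps ^ 2 ^ 2"
  assumes "A \<in> carrier (M2 i)"
  shows "centraliser_GL2 i A \<inter> SL2 i
    = {g. red i g = g \<and> fps_cutoff i (det g) = fps_cutoff i 1 \<and> red i (g ** A) = red i (A ** g)}"
proof -
  have "g \<in> SL2 i \<longleftrightarrow> red i g = g \<and> fps_cutoff i (det g) = fps_cutoff i 1" for g :: "'a fps ^ 2 ^ 2"
    unfolding SL2_def mem_Collect_eq in_M2_iff det_Oi_def by (simp add: Oi_def)
  then show ?thesis
    using SL2_subset_GL2[of i] centraliser_GL2_iff_commute[OF assms] by blast
qed

text \<open>The reduction of the matrix \<open>x + y (A + d)\<close> mod \<open>t\<^sup>i\<close>.\<close>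
definition shifted_span ::
  "nat \<Rightarrow> 'a::field fps ^ 2 ^ 2 \<Rightarrow> 'a fps \<Rightarrow> 'a fps \<times> 'a fps \<Rightarrow> 'a fps ^ 2 ^ 2" where
  "shifted_span i A d = (\<lambda>(x, y). red i (\<chi> j k. y * A $ j $ k + (if j = k then x + y * d else 0)))"

lemma shifted_span_nth:
  "shifted_span i A d (x, y) $ j $ k
     = fps_cutoff i (y * A $ j $ k + (if j = k then x + y * d else 0))"
  by (simp add: shifted_span_def red_def)

lemma det_shifted_span:
  fixes A :: "'a::field fps ^ 2 ^ 2"
  assumes "CHAR('a) = 2"
  shows "fps_cutoff i (det (shifted_span i A d (x, y)))
    = fps_cutoff i (norm_form (trace A) (det A + d * trace A + d\<^sup>2) (x, y))"
proof -
  have "fps_cutoff i (det (shifted_span i A d (x, y)))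
      = fps_cutoff i ((y * A $ 1 $ 1 + (x + y * d)) * (y * A $ 2 $ 2 + (x + y * d))
          - y * A $ 1 $ 2 * (y * A $ 2 $ 1))"
    unfolding det_2 shifted_span_nth
    by (rule fps_cutoff_diff_cong; rule fps_cutoff_mult_cong) (simp_all add: fps_cutoff_idem)
  also have "(y * A $ 1 $ 1 + (x + y * d)) * (y * A $ 2 $ 2 + (x + y * d))
          - y * A $ 1 $ 2 * (y * A $ 2 $ 1)
      = (x + y * d)\<^sup>2 + trace A * x * y + (det A + d * trace A) * y\<^sup>2"
    by (simp add: det_2 trace_def sum_2 power2_eq_square algebra_simps)
  also have "(x + y * d)\<^sup>2 = x\<^sup>2 + d\<^sup>2 * y\<^sup>2"
    using assms by (simp add: square_add_CHAR_2 power_mult_distrib mult.commute)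
  also have "x\<^sup>2 + d\<^sup>2 * y\<^sup>2 + trace A * x * y + (det A + d * trace A) * y\<^sup>2
      = norm_form (trace A) (det A + d * trace A + d\<^sup>2) (x, y)"
    by (simp add: norm_form_def algebra_simps)
  finally show ?thesis .
qed

lemma shifted_span_commute:
  "red i (shifted_span i A d p ** A) = red i (A ** shifted_span i A d p)"
proof -
  obtain x y where p: "p = (x, y)" by (cases p)
  let ?Z = "\<chi> j k. y * A $ j $ k + (if j = k then x + y * d else 0)"
  have "?Z ** A = A ** ?Z"
    by (simp add: vec_eq_iff forall_2 matrix_matrix_mult_def sum_2 algebra_simps)
  moreover have "red i (red i ?Z ** A) = red i (?Z ** A)" "red i (A ** red i ?Z) = red i (A ** ?Z)"
    using red_mult[of i "red i ?Z" A] red_mult[of i ?Z A] red_mult[of i A "red i ?Z"] red_mult[of i A ?Z]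
    by (simp_all only: red_idem)
  ultimately show ?thesis
    by (simp add: shifted_span_def p)
qed

lemma bij_betw_shifted_span:
  fixes A :: "'a::field fps ^ 2 ^ 2"
  assumes char2: "CHAR('a) = 2"
    and nonscalar: "fps_nth (A $ 1 $ 2) 0 \<noteq> 0 \<or> fps_nth (A $ 2 $ 1) 0 \<noteq> 0"
  shows "bij_betw (shifted_span i A d)
    (norm_one_pairs (trace A) (det A + d * trace A + d\<^sup>2) i i)
    {g. red i g = g \<and> fps_cutoff i (det g) = fps_cutoff i 1 \<and> red i (g ** A) = red i (A ** g)}"
    (is "bij_betw _ ?S ?C")
proof (rule bij_betw_imageI)
  show "inj_on (shifted_span i A d) ?S"
  proof (rule inj_onI)
    fix p p' assume p: "p \<in> ?S" "p' \<in> ?S" "shifted_span i A d p = shifted_span i A d p'"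
    obtain x y x' y' where [simp]: "p = (x, y)" "p' = (x', y')"
      by (cases p; cases p')
    have entry: "fps_cutoff i (y * A $ j $ k + (if j = k then x + y * d else 0))
        = fps_cutoff i (y' * A $ j $ k + (if j = k then x' + y' * d else 0))" for j k
      using p(3) shifted_span_nth[of i A d x y j k] shifted_span_nth[of i A d x' y' j k] by simp
    have "fps_cutoff i (A $ 1 $ 2 * y) = fps_cutoff i (A $ 1 $ 2 * y')"
      "fps_cutoff i (A $ 2 $ 1 * y) = fps_cutoff i (A $ 2 $ 1 * y')"
      using entry[of 1 2] entry[of 2 1] by (simp_all add: mult.commute)
    then have "fps_cutoff i y = fps_cutoff i y'"
      using nonscalar fps_cutoff_mult_cancel_unit by blast
    then have y: "y = y'"
      using p by (simp add: norm_one_pairs_def)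
    then have "fps_cutoff i x = fps_cutoff i x'"
      using entry[of 1 1] by (simp add: fps_cutoff_add)
    with y show "p = p'"
      using p by (simp add: norm_one_pairs_def)
  qed
  show "shifted_span i A d ` ?S = ?C"
  proof (intro equalityI subsetI)
    fix g assume "g \<in> shifted_span i A d ` ?S"
    then obtain x y where xy: "(x, y) \<in> ?S" and g: "g = shifted_span i A d (x, y)"
      by auto
    have "red i g = g"
      by (simp add: g shifted_span_def red_idem)
    then show "g \<in> ?C"
      using xy det_shifted_span[OF char2, of i A d x y] shifted_span_commute[of i A d "(x, y)"]
      by (simp add: norm_one_pairs_def g)
  next
    fix g assume "g \<in> ?C"
    then have g: "red i g = g" "fps_cutoff i (det g) = fps_cutoff i 1" "red i (g ** A) = red i (A ** g)"
      by auto
    obtain y where y: "fps_cutoff i (g $ 1 $ 2) = fps_cutoff i (y * A $ 1 $ 2)"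
      "fps_cutoff i (g $ 2 $ 1) = fps_cutoff i (y * A $ 2 $ 1)"
      "fps_cutoff i (g $ 1 $ 1 - g $ 2 $ 2) = fps_cutoff i (y * (A $ 1 $ 1 - A $ 2 $ 2))"
      using commutant_entries[OF nonscalar g(3)] by blast
    define x where "x = g $ 1 $ 1 - y * (A $ 1 $ 1 + d)"
    have cg: "fps_cutoff i (g $ j $ k) = g $ j $ k" for j k
      using g(1) by (simp add: red_def vec_eq_iff)
    have span: "shifted_span i A d (fps_cutoff i x, fps_cutoff i y) = shifted_span i A d (x, y)"
      unfolding vec_eq_iff shifted_span_nth
      by (intro allI fps_cutoff_add_cong fps_cutoff_mult_cong)
        (simp_all add: fps_cutoff_idem fps_cutoff_add, metis fps_cutoff_mult fps_cutoff_idem)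
    have "fps_cutoff i (y * A $ 2 $ 2 + (x + y * d)) = fps_cutoff i (g $ 1 $ 1 - y * (A $ 1 $ 1 - A $ 2 $ 2))"
      by (simp add: x_def algebra_simps)
    also have "\<dots> = fps_cutoff i (g $ 1 $ 1 - (g $ 1 $ 1 - g $ 2 $ 2))"
      by (intro fps_cutoff_diff_cong refl y(3)[symmetric])
    finally have 22: "fps_cutoff i (y * A $ 2 $ 2 + (x + y * d)) = g $ 2 $ 2"
      by (simp add: cg)
    have 11: "fps_cutoff i (y * A $ 1 $ 1 + (x + y * d)) = g $ 1 $ 1"
      using cg[of 1 1] by (simp add: x_def algebra_simps)
    have gxy: "g = shifted_span i A d (x, y)"
      using y(1,2) 11 22 cg by (simp add: vec_eq_iff forall_2 shifted_span_nth)
    have "(fps_cutoff i x, fps_cutoff i y) \<in> ?S"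
      using det_shifted_span[OF char2, of i A d x y] g(2) gxy
      by (simp add: norm_one_pairs_def fps_cutoff_idem fps_cutoff_norm_form_trunc)
    then show "g \<in> shifted_span i A d ` ?S"
      using gxy span by (intro image_eqI[where x = "(fps_cutoff i x, fps_cutoff i y)"]) simp_all
  qed
qed

section \<open>Type 3 matrices and their odd depth\<close>

lemma type3_residue:
  fixes A :: "'a::field fps ^ 2 ^ 2"
  assumes char2: "CHAR('a) = 2" and n: "1 \<le> n" and "type3 n A"
  shows "fps_nth (trace A) 0 = 0"
    and "fps_nth (A $ 1 $ 2) 0 \<noteq> 0 \<or> fps_nth (A $ 2 $ 1) 0 \<noteq> 0"
proof -
  interpret ring "M2 n :: ('a fps ^ 2 ^ 2) ring"
    by (rule ring_M2)
  obtain g \<Delta> \<tau> a where g: "g \<in> Units (M2 n)" and conj: "conj_M2 n g A = companion2 \<Delta> \<tau>"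
    and dvd: "[:fps_X:] dvd [:\<Delta>, \<tau>, 1:] - [:- a, 1:] ^ 2"
    using assms(3) unfolding type3_def GL2_def by blast
  define h where "h = inv\<^bsub>M2 n\<^esub> g"
  \<comment> \<open>Everything is read off after reduction mod \<open>t\<close>.\<close>
  define res :: "'a fps ^ 2 ^ 2 \<Rightarrow> 'a ^ 2 ^ 2" where "res = map_matrix (\<lambda>f. fps_nth f 0)"
  have res_mult: "res (B ** B') = res B ** res B'" for B B'
    by (simp add: res_def vec_eq_iff matrix_matrix_mult_def sum_2)
  have res_red: "res (red n B) = res B" for B
    using n by (simp add: res_def red_def vec_eq_iff)
  have "res (g \<otimes>\<^bsub>M2 n\<^esub> h) = res \<one>\<^bsub>M2 n\<^esub>" "res (h \<otimes>\<^bsub>M2 n\<^esub> g) = res \<one>\<^bsub>M2 n\<^esub>"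
    using g by (simp_all only: h_def Units_r_inv Units_l_inv)
  moreover have "res (mat 1) = mat 1"
    by (simp add: res_def vec_eq_iff mat_def)
  ultimately have gh: "res g ** res h = mat 1" "res h ** res g = mat 1"
    by (simp_all add: M2_mult M2_one res_red res_mult)
  have C: "res (companion2 \<Delta> \<tau>) = res g ** res A ** res h"
    unfolding conj[symmetric] conj_M2_def h_def[symmetric] M2_mult res_red res_mult ..
  have Centries: "res (companion2 \<Delta> \<tau>) $ 1 $ 1 = 0" "res (companion2 \<Delta> \<tau>) $ 1 $ 2 = 1"
    "res (companion2 \<Delta> \<tau>) $ 2 $ 2 = fps_nth \<tau> 0"
    by (simp_all add: res_def companion2_def)
  have "fps_X dvd Polynomial.coeff ([:\<Delta>, \<tau>, 1:] - [:- a, 1:] ^ 2) 1"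
    using dvd by (simp only: const_poly_dvd_iff)
  moreover have "Polynomial.coeff ([:\<Delta>, \<tau>, 1:] - [:- a, 1:] ^ 2) 1 = \<tau> + (a + a)"
    by (simp add: power2_eq_square)
  moreover have "a + a = 0"
    using char2 by (intro add_self_CHAR_2) simp
  ultimately have "fps_X dvd \<tau>"
    by simp
  then have \<tau>0: "fps_nth \<tau> 0 = 0"
    by (auto elim!: dvdE)
  have "trace (res A) = trace (res A ** (res h ** res g))"
    by (simp add: gh)
  also have "\<dots> = trace (res g ** (res A ** res h))"
    using trace_mul_sym[of "res g" "res A ** res h"] by (simp add: matrix_mul_assoc)
  also have "\<dots> = trace (res (companion2 \<Delta> \<tau>))"
    by (simp add: C matrix_mul_assoc)
  also have "\<dots> = 0"
    by (simp add: trace_def sum_2 Centries \<tau>0)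
  finally have tr: "fps_nth (A $ 1 $ 1) 0 + fps_nth (A $ 2 $ 2) 0 = 0"
    by (simp add: trace_def sum_2 res_def)
  then show "fps_nth (trace A) 0 = 0"
    by (simp add: trace_def sum_2)
  show "fps_nth (A $ 1 $ 2) 0 \<noteq> 0 \<or> fps_nth (A $ 2 $ 1) 0 \<noteq> 0"
  proof (rule ccontr)
    \<comment> \<open>Otherwise \<open>A\<close> and hence its companion matrix would be scalar mod \<open>t\<close>.\<close>
    assume "\<not> ?thesis"
    then have off: "fps_nth (A $ 1 $ 2) 0 = 0" "fps_nth (A $ 2 $ 1) 0 = 0" by auto
    have eq: "fps_nth (A $ 1 $ 1) 0 = fps_nth (A $ 2 $ 2) 0"
      using tr minus_CHAR_2[OF char2] by (metis eq_iff_diff_eq_0)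
    have "res (companion2 \<Delta> \<tau>) $ 1 $ 2 = fps_nth (A $ 2 $ 2) 0 * (res g ** res h) $ 1 $ 2"
      unfolding C by (simp add: matrix_matrix_mult_def sum_2 res_def off eq algebra_simps)
    then show False
      using gh(1) Centries(2) by (simp add: mat_def)
  qed
qed

text \<open>
  The shift by \<open>d\<close> cancels the even coefficients of the determinant below \<open>t\<^sup>w\<close> and leaves the odd
  ones unchanged, because \<open>d T\<close> vanishes mod \<open>t\<^sup>w\<close>.
\<close>
lemma depth_form_tr_val_odd_depth:
  fixes A :: "'a::{field,finite} fps ^ 2 ^ 2"
  assumes char2: "CHAR('a) = 2" and i: "1 \<le> i" and tr0: "fps_nth (trace A) 0 = 0"
    and d: "\<And>k. (fps_nth d k)\<^sup>2 = fps_nth (det A) (2 * k)"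
  shows "depth_form (trace A) (det A + d * trace A + d\<^sup>2) i (tr_val i A) (odd_depth i A)"
proof -
  define w where "w = tr_val i A"
  define \<delta> where "\<delta> = odd_depth i A"
  define D where "D = det A + d * trace A + d\<^sup>2"
  have w: "1 \<le> w \<and> w \<le> i \<and> (\<forall>j<w. fps_nth (trace A) j = 0) \<and> (w < i \<longrightarrow> fps_nth (trace A) w \<noteq> 0)"
  proof (cases "tr_Oi i A = 0")
    case True
    then have "fps_nth (trace A) j = 0" if "j < i" for j
      using that unfolding tr_Oi_def by (metis fps_cutoff_nth fps_zero_nth)
    with True i show ?thesis
      by (simp add: w_def tr_val_def)
  next
    case False
    then have sub: "w = subdegree (tr_Oi i A)"
      by (simp add: w_def tr_val_def)
    have nz: "fps_nth (tr_Oi i A) w \<noteq> 0"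
      using False sub by simp
    then have wi: "w < i" "fps_nth (trace A) w \<noteq> 0"
      by (auto simp: tr_Oi_def split: if_splits)
    moreover have "fps_nth (trace A) j = 0" if "j < w" for j
      using that nth_less_subdegree_zero[of j "tr_Oi i A"] sub wi(1) by (simp add: tr_Oi_def)
    moreover have "w \<noteq> 0"
      using wi(2) tr0 by metis
    ultimately show ?thesis by simp
  qed
  have Dj: "fps_nth D j = (if even j then 0 else fps_nth (det A) j)" if "j < w" for j
  proof -
    have "fps_nth (d * trace A) j = 0"
      using fps_mult_nth_eq_0[of w "trace A" j d] w that by (simp add: mult.commute)
    then show ?thesis
      using d add_self_CHAR_2[OF char2] by (auto simp: D_def fps_square_nth_CHAR_2 char2 elim!: evenE)
  qed
  have det_nth: "fps_nth (det_Oi i A) (2 * k + 1) = fps_nth (det A) (2 * k + 1)" if "k < w div 2" for k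
  proof -
    have "2 * k + 1 < i"
      using that w by linarith
    then show ?thesis
      by (simp add: det_Oi_def)
  qed
  let ?P = "\<lambda>k. k < w div 2 \<and> fps_nth (det_Oi i A) (2 * k + 1) \<noteq> 0"
  have \<delta>_eq: "\<delta> = (if \<exists>k. ?P k then LEAST k. ?P k else w div 2)"
    by (simp only: \<delta>_def odd_depth_def w_def Let_def)
  have low: "fps_nth (det A) (2 * k + 1) = 0" if "k < \<delta>" "k < w div 2" for k
  proof -
    have "\<not> ?P k"
      using that not_less_Least[of k ?P] unfolding \<delta>_eq by (auto split: if_splits)
    then show ?thesis
      using that det_nth by simp
  qed
  have main: "2 * \<delta> \<le> w \<and> (2 * \<delta> + 1 < w \<and> D \<noteq> 0 \<and> subdegree D = 2 * \<delta> + 1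
      \<or> w \<le> 2 * \<delta> + 1 \<and> (\<forall>j<w. fps_nth D j = 0))"
  proof (cases "\<exists>k. ?P k")
    case True
    then have "?P \<delta>"
      unfolding \<delta>_eq using LeastI_ex[of ?P] by simp
    then have dw: "2 * \<delta> + 1 < w" and nz: "fps_nth (det A) (2 * \<delta> + 1) \<noteq> 0"
      using det_nth[of \<delta>] by auto
    have nzD: "fps_nth D (2 * \<delta> + 1) \<noteq> 0"
      using Dj[OF dw] nz by simp
    have "fps_nth D j = 0" if "j < 2 * \<delta> + 1" for j
      using that dw Dj[of j] low[of "j div 2"] by (cases "even j") (auto elim!: oddE)
    with nzD have "subdegree D = 2 * \<delta> + 1"
      by (intro subdegreeI)
    then show ?thesis
      using dw nzD by auto
  next
    case False
    then have \<delta>: "\<delta> = w div 2"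
      unfolding \<delta>_eq by (rule if_not_P)
    have "fps_nth D j = 0" if "j < w" for j
    proof (cases "even j")
      case False
      then obtain k where "j = 2 * k + 1" by (auto elim: oddE)
      then show ?thesis
        using that Dj[of j] low[of k] \<delta> by auto
    qed (use that Dj in simp)
    then show ?thesis
      using \<delta> by auto
  qed
  show ?thesis
    unfolding w_def[symmetric] \<delta>_def[symmetric] D_def[symmetric]
    by unfold_locales (use char2 w main in auto)
qed

section \<open>The order of the centraliser\<close>

theorem lemma4p21:
  fixes q e r i :: nat
    and \<beta> \<beta>h :: "('a::{field,finite}) fps ^ 2 ^ 2"
  assumes "CARD('a) = q" and "q = 2 ^ e"
    and "r \<ge> 2"
    and "\<beta> \<in> carrier (M2 (r div 2))" and "type3 (r div 2) \<beta>"
    and "\<beta>h \<in> carrier (M2 r)" and "red (r div 2) \<beta>h = \<beta>"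
    and "1 \<le> i" and "i \<le> r"
  shows "\<exists>c \<in> {1, 2, 3 :: nat}.
    card (centraliser_GL2 i (red i \<beta>h) \<inter> SL2 i) = c * q ^ (i + odd_depth i (red i \<beta>h))"
proof -
  define A where "A = red i \<beta>h"
  have char2: "CHAR('a) = 2"
    using assms(1,2) by (intro CHAR_eq_2I) simp
  have n: "1 \<le> r div 2"
    using assms(3) by simp
  have const: "fps_nth (A $ j $ k) 0 = fps_nth (\<beta> $ j $ k) 0" for j k
    using n assms(7,8) by (auto simp: A_def red_def)
  have nonscalar: "fps_nth (A $ 1 $ 2) 0 \<noteq> 0 \<or> fps_nth (A $ 2 $ 1) 0 \<noteq> 0"
    using type3_residue(2)[OF char2 n assms(5)] by (simp only: const)
  have tr0: "fps_nth (trace A) 0 = 0"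
    using type3_residue(1)[OF char2 n assms(5)] by (simp add: trace_def sum_2 const)
  have "\<forall>k. \<exists>s. s\<^sup>2 = fps_nth (det A) (2 * k)"
    by (intro allI ex_sqrt_CHAR_2 char2)
  from choice[OF this] obtain s where s: "\<forall>k. (s k)\<^sup>2 = fps_nth (det A) (2 * k)" ..
  define d where "d = Abs_fps s"
  have d: "(fps_nth d k)\<^sup>2 = fps_nth (det A) (2 * k)" for k
    using s by (simp add: d_def)
  let ?S = "norm_one_pairs (trace A) (det A + d * trace A + d\<^sup>2) i i"
  interpret depth_form "trace A" "det A + d * trace A + d\<^sup>2" i "tr_val i A" "odd_depth i A"
    by (rule depth_form_tr_val_odd_depth[OF char2 assms(8) tr0 d])
  obtain c where c: "c \<in> {1, 2}" "card ?S = c * q ^ (i + odd_depth i A)"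
    using card_norm_one_pairs assms(1) by auto
  have "A \<in> carrier (M2 i)"
    unfolding in_M2_iff A_def by (rule red_idem)
  then have "card (centraliser_GL2 i A \<inter> SL2 i) = card ?S"
    using bij_betw_same_card[OF bij_betw_shifted_span[OF char2 nonscalar, of i d]]
    by (simp only: centraliser_SL2_eq)
  with c show ?thesis
    unfolding A_def by auto
qed

end
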